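(* There is an $\epsilon>0$ such that, for all sufficiently large $N$, the number of integral points $(x,y,z)\in\mathbb{Z}^3$ on the surface $xyz=x^3+y^3+1$ satisfying $1\le x,y\le N$ is at least $\epsilon\log N\,\log\log N$. *)

theory Defs
  imports Complex_Main
begin

(* For fixed x, y >= 1 the equation determines z, so each of these sets is finite
   and its cardinality is the number of points. *)
definition points_upto :: "real \<Rightarrow> (int \<times> int \<times> int) set" where
  "points_upto N = {(x, y, z). x * y * z = x ^ 3 + y ^ 3 + 1 \<and>
     1 \<le> x \<and> real_of_int x \<le> N \<and> 1 \<le> y \<and> real_of_int y \<le> N}"

end

theory Submission
  imports Defs
begin

text \<open>
  Write \<open>k = (x\<^sup>2 + y\<^sup>2 - x - y + 1) / (x y)\<close>, so that the equation of the surface becomes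
  \<open>z - 3 = (k - 1) (x + y + 1)\<close>. For fixed rational \<open>k = P / Q > 2\<close> the points lie on a conic, on
  which the solutions of the Pell equation \<open>\<tau>\<^sup>2 - (P\<^sup>2 - 4 Q\<^sup>2) \<mu>\<^sup>2 = 1\<close> act. Its fundamental
  unit is usually far too large, but there is an exponentially growing sequence of conics, indexed
  by the solutions of \<open>a\<^sup>2 = 45 b\<^sup>2 + 1\<close>, with \<open>Q = 96 b\<^sup>2 + 1\<close> and \<open>P = 7 Q - 6\<close>, each with an
  explicit integral point and an explicit unit, both polynomial in \<open>a\<close> and \<open>b\<close>. Hence the
  \<open>m\<close>-th point on the \<open>j\<close>-th conic has size at most \<open>C ^ (j m)\<close>, and counting the pairs
  with \<open>j m \<le> M\<close>, where \<open>M\<close> is a constant multiple of \<open>log N\<close>, gives the order \<open>M log M\<close>.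
\<close>

section \<open>Rotations of a conic\<close>

definition on_conic :: "int \<Rightarrow> int \<Rightarrow> int \<Rightarrow> int \<Rightarrow> bool" where
  "on_conic P Q x y \<longleftrightarrow> Q * (x\<^sup>2 + y\<^sup>2 - x - y + 1) = P * x * y"

text \<open>The factorisation of X^3 + Y^3 + Z^3 - 3 X Y Z at Z = 1 splits off x + y + 1.
  Divisibility of that factor by \<open>Q\<close> cancels the denominator of k = P / Q.\<close>

lemma surface_point_of_conic_point:
  fixes P Q x y n :: int
  assumes "on_conic P Q x y" "x + y + 1 = Q * n"
  shows "x * y * (3 + (P - Q) * n) = x ^ 3 + y ^ 3 + 1"
proof -
  have "x ^ 3 + y ^ 3 + 1 - 3 * x * y = (x + y + 1) * (x\<^sup>2 + y\<^sup>2 - x - y + 1 - x * y)"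
    by algebra
  also have "\<dots> = n * (Q * (x\<^sup>2 + y\<^sup>2 - x - y + 1) - Q * x * y)"
    unfolding assms(2) by algebra
  also have "\<dots> = n * (P * x * y - Q * x * y)"
    using assms(1) by (simp add: on_conic_def)
  finally show ?thesis
    by (simp add: algebra_simps)
qed

text \<open>In the coordinates \<open>A x + Q\<close>, \<open>A y + Q\<close> the conic is centred at the origin.\<close>

lemma on_conic_iff_centred:
  fixes A P Q x y :: int
  assumes "P = A + 2 * Q" "A \<noteq> 0"
  shows "on_conic P Q x y \<longleftrightarrow>
    Q * (A * x + Q)\<^sup>2 - P * (A * x + Q) * (A * y + Q) + Q * (A * y + Q)\<^sup>2 = - A * Q * (A + Q)"
proof -
  have "Q * (A * x + Q)\<^sup>2 - P * (A * x + Q) * (A * y + Q) + Q * (A * y + Q)\<^sup>2 + A * Q * (A + Q)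
      = A\<^sup>2 * (Q * (x\<^sup>2 + y\<^sup>2 - x - y + 1) - P * x * y)"
    unfolding assms(1) by algebra
  then show ?thesis
    unfolding on_conic_def using assms(2)
    by (smt (verit) mult_eq_0_iff mult_minus_left zero_eq_power2)
qed

text \<open>The form splits into two conjugate linear factors over the square root of D = P^2 - 4
  Q^2. The map multiplies them by t - u sqrt D and t + u sqrt D, whose product is 1.\<close>

lemma form_rotation:
  fixes P Q t u X Y :: int
  assumes "t\<^sup>2 - (P\<^sup>2 - 4 * Q\<^sup>2) * u\<^sup>2 = 1"
  defines "X' \<equiv> (t + P * u) * X - 2 * Q * u * Y" and "Y' \<equiv> 2 * Q * u * X + (t - P * u) * Y"
  shows "Q * X'\<^sup>2 - P * X' * Y' + Q * Y'\<^sup>2 = Q * X\<^sup>2 - P * X * Y + Q * Y\<^sup>2"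
proof -
  have "Q * X'\<^sup>2 - P * X' * Y' + Q * Y'\<^sup>2
      = (t\<^sup>2 - (P\<^sup>2 - 4 * Q\<^sup>2) * u\<^sup>2) * (Q * X\<^sup>2 - P * X * Y + Q * Y\<^sup>2)"
    unfolding X'_def Y'_def by algebra
  then show ?thesis
    using assms(1) by simp
qed

text \<open>The translation part (c, d) comes from rotating about the centre (- Q / A, - Q / A); the
  last two hypotheses say that it is integral.\<close>

lemma on_conic_rotation:
  fixes A P Q t u c d x y :: int
  assumes "on_conic P Q x y" and P: "P = A + 2 * Q" and "A \<noteq> 0"
    and "t\<^sup>2 - (P\<^sup>2 - 4 * Q\<^sup>2) * u\<^sup>2 = 1"
    and c: "A * c = Q * (t - 1 + A * u)" and d: "A * d = Q * (t - 1 - A * u)"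
  shows "on_conic P Q ((t + P * u) * x - 2 * Q * u * y + c) (2 * Q * u * x + (t - P * u) * y + d)"
proof -
  have X: "A * ((t + P * u) * x - 2 * Q * u * y + c) + Q
      = (t + P * u) * (A * x + Q) - 2 * Q * u * (A * y + Q)"
    using c unfolding P by algebra
  have Y: "A * (2 * Q * u * x + (t - P * u) * y + d) + Q
      = 2 * Q * u * (A * x + Q) + (t - P * u) * (A * y + Q)"
    using d unfolding P by algebra
  show ?thesis
    unfolding on_conic_iff_centred[OF P \<open>A \<noteq> 0\<close>] X Y form_rotation[OF assms(4)]
    using assms(1) unfolding on_conic_iff_centred[OF P \<open>A \<noteq> 0\<close>] .
qed

lemma rotation_increases:
  fixes A P Q t u c d x y :: int
  assumes "1 \<le> y" "y \<le> x" and P: "P = A + 2 * Q" and pos: "A > 0" "Q > 0" "u > 0" "t > 0"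
    and unit: "t\<^sup>2 - (P\<^sup>2 - 4 * Q\<^sup>2) * u\<^sup>2 = 1"
    and "0 \<le> d" "d \<le> c"
  defines "x' \<equiv> (t + P * u) * x - 2 * Q * u * y + c" and "y' \<equiv> 2 * Q * u * x + (t - P * u) * y + d"
  shows "1 \<le> y'" "y' \<le> x'" "x < x'"
proof -
  \<comment> \<open>P^2 - 4 Q^2 = A (A + 4 Q). The resulting bound A u < t makes all coefficients
    nonnegative once the new coordinates are written in terms of x - y and y.\<close>
  have "t\<^sup>2 = 1 + (A * u)\<^sup>2 + 4 * Q * A * u\<^sup>2"
    using unit unfolding P by (simp add: power2_eq_square algebra_simps)
  moreover have "4 * Q * A * u\<^sup>2 > 0"
    using pos by simp
  ultimately have "A * u < t"
    using \<open>t > 0\<close> by (intro power2_less_imp_less[of _ t]) linarith+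
  moreover have Au: "A * u > 0"
    using pos by simp
  moreover have y': "y' = 2 * Q * u * (x - y) + (t - A * u) * y + d"
    unfolding y'_def P by (simp add: algebra_simps)
  moreover have "2 * Q * u * (x - y) \<ge> 0"
    using pos \<open>y \<le> x\<close> by simp
  moreover have "(t - A * u) * y \<ge> 1 * 1"
    using \<open>A * u < t\<close> \<open>1 \<le> y\<close> by (intro mult_mono) auto
  ultimately show "1 \<le> y'"
    using \<open>0 \<le> d\<close> by linarith
  have "x' - y' = t * (x - y) + A * u * (x + y) + (c - d)"
    unfolding x'_def y'_def P by (simp add: algebra_simps)
  moreover have "t * (x - y) \<ge> 0" "A * u * (x + y) \<ge> 0"
    using \<open>1 \<le> y\<close> \<open>y \<le> x\<close> \<open>t > 0\<close> Au by auto
  ultimately show "y' \<le> x'"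
    using \<open>d \<le> c\<close> by linarith
  have "x' - x = (t - 1) * x + A * u * x + 2 * Q * u * (x - y) + c"
    unfolding x'_def P by (simp add: algebra_simps)
  moreover have "(t - 1) * x \<ge> 0" "A * u * x > 0"
    using \<open>1 \<le> y\<close> \<open>y \<le> x\<close> \<open>t > 0\<close> Au by auto
  ultimately show "x < x'"
    using \<open>2 * Q * u * (x - y) \<ge> 0\<close> \<open>0 \<le> d\<close> \<open>d \<le> c\<close> by linarith
qed

section \<open>A sequence of conics with small units\<close>

text \<open>
  All these conics contain a point of a single quartic curve, parametrised by the Pell equation
  \<open>a\<^sup>2 = 45 b\<^sup>2 + 1\<close>, on which \<open>k = P / Q\<close> has the form \<open>7 - 6 / Q\<close>; \<open>base\<close> is that point.
\<close>

definition Qc :: "int \<Rightarrow> int" where "Qc b = 96 * b\<^sup>2 + 1"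
definition Ac :: "int \<Rightarrow> int" where "Ac b = 480 * b\<^sup>2 - 1"
definition Pc :: "int \<Rightarrow> int" where "Pc b = 672 * b\<^sup>2 + 1"
definition ec :: "int \<Rightarrow> int" where "ec b = 6 * b * (160 * b\<^sup>2 + 3)"

text \<open>
  With \<open>A = P - 2 Q\<close> and \<open>B = P + 2 Q\<close>, the unit \<open>\<tau> + \<mu> \<surd>(A B)\<close> is the square of
  \<open>(e \<surd>B + 2 a Q \<surd>A) / 2\<close>. As \<open>2 a Q\<close> is a multiple of \<open>Q\<close>, it preserves the
  condition \<open>Q dvd x + y + 1\<close>, which makes \<open>z\<close> integral.
\<close>

definition tau :: "int \<Rightarrow> int \<Rightarrow> int" where "tau a b = 1 + 2 * a\<^sup>2 * Ac b * (Qc b)\<^sup>2"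
definition mu :: "int \<Rightarrow> int \<Rightarrow> int" where "mu a b = a * ec b * Qc b"

definition step :: "int \<Rightarrow> int \<Rightarrow> int \<times> int \<Rightarrow> int \<times> int" where
  "step a b = (\<lambda>(x, y).
     ((tau a b + Pc b * mu a b) * x - 2 * Qc b * mu a b * y + a * (Qc b)\<^sup>2 * (2 * a * Qc b + ec b),
      2 * Qc b * mu a b * x + (tau a b - Pc b * mu a b) * y + a * (Qc b)\<^sup>2 * (2 * a * Qc b - ec b)))"

definition base :: "int \<Rightarrow> int \<Rightarrow> int \<times> int" where
  "base a b = ((168 * b\<^sup>2 + 24 * a * b + 2) * Qc b - 1, (48 * b\<^sup>2 + 1) * Qc b)"

text \<open>The invariant of the orbits. The order \<open>y \<le> x\<close> makes
  \<open>step\<close> increase x, and lets a bound on x control both coordinates.\<close>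

definition good :: "int \<Rightarrow> int \<times> int \<Rightarrow> bool" where
  "good b = (\<lambda>(x, y). 1 \<le> y \<and> y \<le> x \<and> on_conic (Pc b) (Qc b) x y \<and> Qc b dvd x + y + 1)"

definition pell :: "int \<Rightarrow> int \<Rightarrow> bool" where
  "pell a b \<longleftrightarrow> a\<^sup>2 = 45 * b\<^sup>2 + 1 \<and> 0 < a \<and> 24 \<le> b"

lemma pell_bounds:
  assumes "pell a b"
  shows "6 * b < a" "a \<le> 7 * b"
proof -
  have *: "a\<^sup>2 = 45 * b\<^sup>2 + 1" "0 < a" "24 \<le> b"
    using assms by (auto simp: pell_def)
  have b2: "0 < b\<^sup>2"
    using *(3) by simp
  have "(6 * b)\<^sup>2 = 36 * b\<^sup>2" "(7 * b)\<^sup>2 = 49 * b\<^sup>2"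
    by simp_all
  then have "(6 * b)\<^sup>2 < a\<^sup>2" and "a\<^sup>2 \<le> (7 * b)\<^sup>2"
    using *(1) b2 by linarith+
  moreover have "0 \<le> a" and "0 \<le> 7 * b"
    using *(2,3) by linarith+
  ultimately show "6 * b < a" and "a \<le> 7 * b"
    using power2_less_imp_less[of "6 * b" a] power2_le_imp_le[of a "7 * b"] by blast+
qed

lemma unit_identity:
  assumes "a\<^sup>2 = 45 * b\<^sup>2 + 1"
  shows "(tau a b)\<^sup>2 - ((Pc b)\<^sup>2 - 4 * (Qc b)\<^sup>2) * (mu a b)\<^sup>2 = 1"
proof -
  let ?B = "864 * b\<^sup>2 + 3" and ?X = "a\<^sup>2 * Ac b * (Qc b)\<^sup>2"
  have B: "(Pc b)\<^sup>2 - 4 * (Qc b)\<^sup>2 = Ac b * ?B"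
    unfolding Pc_def Qc_def Ac_def by algebra
  \<comment> \<open>The half unit has norm 1. Eliminating a by the Pell equation leaves a polynomial
    identity in b.\<close>
  have X: "?B * (ec b)\<^sup>2 = 4 * ?X + 4"
    unfolding assms ec_def Ac_def Qc_def by algebra
  have "((Pc b)\<^sup>2 - 4 * (Qc b)\<^sup>2) * (mu a b)\<^sup>2 = ?X * (?B * (ec b)\<^sup>2)"
    unfolding B mu_def by (simp only: power_mult_distrib mult_ac)
  also have "\<dots> = (1 + 2 * ?X)\<^sup>2 - 1"
    unfolding X by (simp add: power2_eq_square algebra_simps)
  also have "1 + 2 * ?X = tau a b"
    by (simp add: tau_def)
  finally show ?thesis
    by simp
qed

lemma good_base:
  assumes "pell a b"
  shows "good b (base a b)"
proof -
  have *: "a\<^sup>2 = 45 * b\<^sup>2 + 1" "0 < a" "24 \<le> b"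
    using assms by (auto simp: pell_def)
  have Q: "Qc b \<ge> 1"
    by (simp add: Qc_def)
  have "(48 * b\<^sup>2 + 1) * Qc b \<ge> 1 * 1"
    using Q by (intro mult_mono) auto
  moreover have "(48 * b\<^sup>2 + 1) * Qc b \<le> (168 * b\<^sup>2 + 24 * a * b + 2) * Qc b - 1"
  proof -
    have "(120 * b\<^sup>2 + 24 * a * b + 1) * Qc b \<ge> 1 * 1"
      using Q * by (intro mult_mono) auto
    then show ?thesis
      by (simp add: algebra_simps)
  qed
  moreover have "on_conic (Pc b) (Qc b) ((168 * b\<^sup>2 + 24 * a * b + 2) * Qc b - 1)
      ((48 * b\<^sup>2 + 1) * Qc b)"
    unfolding on_conic_def Pc_def Qc_def using *(1) by algebra
  moreover have "Qc b dvd (168 * b\<^sup>2 + 24 * a * b + 2) * Qc b - 1 + (48 * b\<^sup>2 + 1) * Qc b + 1"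
    by simp
  ultimately show ?thesis
    by (simp add: good_def base_def)
qed

text \<open>The last bound makes the second translation part of \<open>step\<close> nonnegative. It
  follows from 6 b < a, as \<open>ec b\<close> has leading term 960 b^3 and 12 b \<open>Qc b\<close>
  has 1152 b^3.\<close>

lemma positivity:
  assumes "pell a b"
  shows "Qc b > 0" "Ac b > 0" "ec b > 0" "mu a b > 0" "tau a b > 0" "ec b \<le> 2 * a * Qc b"
proof -
  have *: "0 < a" "24 \<le> b"
    using assms by (auto simp: pell_def)
  have b2: "b\<^sup>2 > 0"
    using * by simp
  show Q: "Qc b > 0" and A: "Ac b > 0"
    unfolding Qc_def Ac_def using b2 by linarith+
  show e: "ec b > 0"
    unfolding ec_def using * b2 by (intro mult_pos_pos) linarith+
  show "mu a b > 0"
    using * Q e by (simp add: mu_def)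
  show "tau a b > 0"
    using * Q A by (simp add: tau_def add_pos_pos)
  have "ec b \<le> 2 * (6 * b) * Qc b"
  proof -
    have "3 * b \<le> 32 * b\<^sup>2 * b"
      using * b2 by (intro mult_right_mono) linarith+
    then show ?thesis
      using * by (simp add: ec_def Qc_def algebra_simps)
  qed
  also have "\<dots> \<le> 2 * a * Qc b"
    using pell_bounds[OF assms] Q by (intro mult_right_mono) auto
  finally show "ec b \<le> 2 * a * Qc b" .
qed

lemma good_step:
  assumes "pell a b" "good b p"
  shows "good b (step a b p)" "fst p < fst (step a b p)"
proof -
  obtain x y where p: "p = (x, y)"
    by fastforce
  have *: "1 \<le> y" "y \<le> x" "on_conic (Pc b) (Qc b) x y" "Qc b dvd x + y + 1"
    using assms(2) by (auto simp: p good_def)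
  note pos = positivity[OF assms(1)]
  have "a > 0" and unit: "(tau a b)\<^sup>2 - ((Pc b)\<^sup>2 - 4 * (Qc b)\<^sup>2) * (mu a b)\<^sup>2 = 1"
    using assms(1) unit_identity by (auto simp: pell_def)
  have P: "Pc b = Ac b + 2 * Qc b"
    by (simp add: Pc_def Ac_def Qc_def)
  define c where "c = a * (Qc b)\<^sup>2 * (2 * a * Qc b + ec b)"
  define d where "d = a * (Qc b)\<^sup>2 * (2 * a * Qc b - ec b)"
  define x' where "x' = (tau a b + Pc b * mu a b) * x - 2 * Qc b * mu a b * y + c"
  define y' where "y' = 2 * Qc b * mu a b * x + (tau a b - Pc b * mu a b) * y + d"
  have step: "step a b p = (x', y')"
    by (simp add: step_def p x'_def y'_def c_def d_def)
  have "0 \<le> d" "d \<le> c"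
    using pos \<open>a > 0\<close> by (auto simp: c_def d_def intro!: mult_left_mono)
  note inc = rotation_increases[OF *(1,2) P pos(2,1,4,5) unit this, folded x'_def y'_def]
  have "Ac b * c = Qc b * (tau a b - 1 + Ac b * mu a b)"
    unfolding c_def tau_def mu_def by algebra
  moreover have "Ac b * d = Qc b * (tau a b - 1 - Ac b * mu a b)"
    unfolding d_def tau_def mu_def by algebra
  ultimately have conic: "on_conic (Pc b) (Qc b) x' y'"
    unfolding x'_def y'_def using pos(2) by (intro on_conic_rotation[OF *(3) P _ unit]) auto
  \<comment> \<open>Modulo \<open>Qc b\<close>, \<open>tau\<close> is 1 while \<open>mu\<close>, c
    and d vanish, so \<open>step\<close> fixes the residue of x + y + 1.\<close>
  have "x' + y' + 1 = (x + y + 1) + Qc b * (2 * a\<^sup>2 * Ac b * Qc b * (x + y)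
      + Pc b * a * ec b * (x - y) + 2 * mu a b * (x - y) + 4 * a\<^sup>2 * (Qc b)\<^sup>2)"
    unfolding x'_def y'_def c_def d_def tau_def mu_def by algebra
  then have "Qc b dvd x' + y' + 1"
    using *(4) by (simp only: dvd_add dvd_triv_left)
  with inc conic show "good b (step a b p)" "fst p < fst (step a b p)"
    unfolding step by (simp_all add: good_def p)
qed

text \<open>A crude bound; the exponent \<open>15\<close> leaves room to absorb the constants into powers of \<open>24 \<le> b\<close>.\<close>

lemma step_growth:
  assumes "pell a b" "good b p"
  shows "fst (step a b p) \<le> b ^ 15 * fst p" and "fst (base a b) \<le> b ^ 15"
proof -
  have *: "0 < a" "24 \<le> b"
    using assms(1) by (auto simp: pell_def)
  obtain x y where p: "p = (x, y)"
    by fastforce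
  have xy: "1 \<le> y" "y \<le> x"
    using assms(2) by (auto simp: p good_def)
  note pos = positivity[OF assms(1)]
  have "24 ^ 2 \<le> b\<^sup>2"
    using * by (intro power_mono) auto
  then have b2: "b\<^sup>2 \<ge> 576"
    by simp
  have a: "a \<le> 7 * b"
    using pell_bounds[OF assms(1)] by simp
  have Q: "Qc b \<le> 97 * b\<^sup>2" and A: "Ac b \<le> 480 * b\<^sup>2" and P: "Pc b \<le> 673 * b\<^sup>2"
    using b2 by (auto simp: Qc_def Ac_def Pc_def)
  have e: "ec b \<le> 978 * b ^ 3"
  proof -
    have "ec b \<le> 6 * b * (163 * b\<^sup>2)"
      unfolding ec_def using * b2 by (intro mult_left_mono) auto
    also have "\<dots> = 978 * b ^ 3"
      by (simp add: power_numeral_reduce)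
    finally show ?thesis .
  qed
  have a2: "a\<^sup>2 \<le> (7 * b)\<^sup>2" and Q2: "(Qc b)\<^sup>2 \<le> (97 * b\<^sup>2)\<^sup>2"
    using a Q pos * by (simp_all only: power_mono less_imp_le)
  have "mu a b \<le> (7 * b) * (978 * b ^ 3) * (97 * b\<^sup>2)"
    unfolding mu_def using a e Q pos * by (intro mult_mono) auto
  then have "Pc b * mu a b \<le> (673 * b\<^sup>2) * ((7 * b) * (978 * b ^ 3) * (97 * b\<^sup>2))"
    using P pos * by (intro mult_mono) auto
  also have "\<dots> = 446913726 * b ^ 8"
    by (simp add: power_numeral_reduce)
  finally have 1: "Pc b * mu a b \<le> 446913726 * b ^ 8" .
  have "2 * a\<^sup>2 * Ac b * (Qc b)\<^sup>2 \<le> 2 * (7 * b)\<^sup>2 * (480 * b\<^sup>2) * (97 * b\<^sup>2)\<^sup>2"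
    using a2 A Q2 pos * by (intro mult_mono) auto
  also have "\<dots> = 442599360 * b ^ 8"
    by (simp add: power_numeral_reduce)
  finally have 2: "tau a b \<le> 1 + 442599360 * b ^ 8"
    by (simp add: tau_def)
  have "2 * a * Qc b \<le> 2 * (7 * b) * (97 * b\<^sup>2)"
    using a Q pos * by (intro mult_mono) auto
  also have "\<dots> = 1358 * b ^ 3"
    by (simp add: power_numeral_reduce)
  finally have "2 * a * Qc b + ec b \<le> 2336 * b ^ 3"
    using e by simp
  then have "a * (Qc b)\<^sup>2 * (2 * a * Qc b + ec b) \<le> (7 * b) * (97 * b\<^sup>2)\<^sup>2 * (2336 * b ^ 3)"
    using a Q2 pos * by (intro mult_mono) auto
  also have "\<dots> = 153855968 * b ^ 8"
    by (simp add: power_numeral_reduce)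
  finally have 3: "a * (Qc b)\<^sup>2 * (2 * a * Qc b + ec b) \<le> 153855968 * b ^ 8" .
  \<comment> \<open>The three constants and the 1 from \<open>tau\<close> add up to about 1.04 *
    10^9, below 24^7, which is at most b^7.\<close>
  have "1 \<le> b ^ 8"
    using * by (intro one_le_power) auto
  with 1 2 3 have sum: "tau a b + Pc b * mu a b + a * (Qc b)\<^sup>2 * (2 * a * Qc b + ec b)
      \<le> 24 ^ 7 * b ^ 8"
    by simp
  also have "(24 :: int) ^ 7 * b ^ 8 \<le> b ^ 7 * b ^ 8"
    using * by (intro mult_right_mono power_mono) auto
  also have "\<dots> = b ^ 15"
    by (simp flip: power_add)
  finally have K: "tau a b + Pc b * mu a b + a * (Qc b)\<^sup>2 * (2 * a * Qc b + ec b) \<le> b ^ 15" .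
  have "0 \<le> a * (Qc b)\<^sup>2 * (2 * a * Qc b + ec b)"
    using pos * by simp
  \<comment> \<open>Since x is at least 1, the translation part is absorbed into a multiple of
    x.\<close>
  then have "a * (Qc b)\<^sup>2 * (2 * a * Qc b + ec b) * 1 \<le> a * (Qc b)\<^sup>2 * (2 * a * Qc b + ec b) * x"
    using xy by (intro mult_left_mono) auto
  moreover have "2 * Qc b * mu a b * y \<ge> 0"
    using pos xy by simp
  ultimately have "fst (step a b p) \<le>
      (tau a b + Pc b * mu a b + a * (Qc b)\<^sup>2 * (2 * a * Qc b + ec b)) * x"
    by (simp only: step_def p distrib_right prod.case fst_conv)
  also have "\<dots> \<le> b ^ 15 * x"
    using K xy by (intro mult_right_mono) auto
  finally show "fst (step a b p) \<le> b ^ 15 * fst p"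
    by (simp add: p)

  have "a * b \<le> 7 * b * b"
    using a * by (intro mult_right_mono) auto
  then have "168 * b\<^sup>2 + 24 * a * b + 2 \<le> 337 * b\<^sup>2"
    using b2 by (simp add: power2_eq_square)
  then have "(168 * b\<^sup>2 + 24 * a * b + 2) * Qc b \<le> 337 * b\<^sup>2 * (97 * b\<^sup>2)"
    using Q pos * by (intro mult_mono) auto
  also have "\<dots> = 32689 * b ^ 4"
    by (simp add: power_numeral_reduce)
  also have "\<dots> \<le> 24 ^ 11 * b ^ 4"
    using * by (intro mult_right_mono) auto
  also have "\<dots> \<le> b ^ 11 * b ^ 4"
    using * by (intro mult_right_mono power_mono) auto
  also have "\<dots> = b ^ 15"
    by (simp flip: power_add)
  finally show "fst (base a b) \<le> b ^ 15"
    by (simp add: base_def)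
qed

section \<open>The doubly indexed family of points\<close>

text \<open>Entry j holds the coefficients of (161 + 24 sqrt 45)^(j + 1), the powers of the least
  nontrivial solution.\<close>

primrec pell_seq :: "nat \<Rightarrow> int \<times> int" where
  "pell_seq 0 = (161, 24)"
| "pell_seq (Suc j) = (case pell_seq j of (a, b) \<Rightarrow> (161 * a + 1080 * b, 24 * a + 161 * b))"

abbreviation pa :: "nat \<Rightarrow> int" where "pa j \<equiv> fst (pell_seq j)"
abbreviation pb :: "nat \<Rightarrow> int" where "pb j \<equiv> snd (pell_seq j)"

lemma pell_pell_seq: "pell (pa j) (pb j)"
proof (induction j)
  case 0
  then show ?case
    by (simp add: pell_def)
next
  case (Suc j)
  then have *: "(pa j)\<^sup>2 = 45 * (pb j)\<^sup>2 + 1" "0 < pa j" "24 \<le> pb j"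
    by (auto simp: pell_def)
  have "(161 * pa j + 1080 * pb j)\<^sup>2 = 45 * (24 * pa j + 161 * pb j)\<^sup>2 + 1"
    using *(1) by algebra
  with * show ?case
    by (simp add: pell_def case_prod_beta)
qed

lemma strict_mono_pb: "strict_mono pb"
proof (intro strict_mono_Suc_iff[THEN iffD2] allI)
  fix j
  show "pb j < pb (Suc j)"
    using pell_pell_seq[of j] by (simp add: pell_def case_prod_beta)
qed

lemma pb_le: "pb j \<le> 329 ^ Suc j"
proof (induction j)
  case 0
  then show ?case
    by simp
next
  case (Suc j)
  \<comment> \<open>329 = 24 * 7 + 161, from a <= 7 b.\<close>
  have "pb (Suc j) \<le> 329 * pb j"
    using pell_bounds(2)[OF pell_pell_seq[of j]] by (simp add: case_prod_beta)
  with Suc show ?case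
    by simp
qed

definition pt :: "nat \<Rightarrow> nat \<Rightarrow> int \<times> int" where
  "pt j m = (step (pa j) (pb j) ^^ m) (base (pa j) (pb j))"

lemma good_pt: "good (pb j) (pt j m)"
  by (induction m) (auto simp: pt_def good_base pell_pell_seq good_step)

lemma strict_mono_pt: "strict_mono (\<lambda>m. fst (pt j m))"
  unfolding strict_mono_Suc_iff
  using good_step(2)[OF pell_pell_seq good_pt] by (simp add: pt_def)

text \<open>Each step costs a factor b^15 and b is exponential in j, so the two indices multiply in
  the exponent.\<close>

lemma pt_le: "fst (pt j m) \<le> (329 ^ 15) ^ (Suc j * Suc m)"
proof -
  have "fst (pt j m) \<le> (pb j ^ 15) ^ Suc m"
  proof (induction m)
    case 0
    show ?case
      using step_growth(2)[OF pell_pell_seq good_pt] by (simp add: pt_def)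
  next
    case (Suc m)
    have "fst (pt j (Suc m)) \<le> pb j ^ 15 * fst (pt j m)"
      using step_growth(1)[OF pell_pell_seq good_pt] by (simp add: pt_def)
    also have "\<dots> \<le> pb j ^ 15 * (pb j ^ 15) ^ Suc m"
      using Suc pell_pell_seq[of j] by (intro mult_left_mono) (auto simp: pell_def)
    finally show ?case
      by simp
  qed
  also have "\<dots> \<le> ((329 ^ Suc j) ^ 15) ^ Suc m"
    using pb_le[of j] pell_pell_seq[of j] by (intro power_mono) (auto simp: pell_def)
  also have "\<dots> = (329 ^ 15) ^ (Suc j * Suc m)"
    by (simp only: flip: power_mult) (simp only: mult_ac)
  finally show ?thesis .
qed

text \<open>A point determines k = P / Q = 7 - 6 / Q, and hence Q. The factor cancelled at the end
  is nonzero because its product with \<open>Qc b\<close> is 6 x y.\<close>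

lemma conic_unique:
  assumes "good b (x, y)" "good b' (x, y)"
  shows "Qc b = Qc b'"
proof -
  have *: "Pc b = 7 * Qc b - 6" for b
    by (simp add: Pc_def Qc_def)
  have "Qc b * (7 * x * y - (x\<^sup>2 + y\<^sup>2 - x - y + 1)) = 6 * x * y" if "good b (x, y)" for b
    using that unfolding good_def on_conic_def * by (simp add: algebra_simps)
  from this[OF assms(1)] this[OF assms(2)]
  have "Qc b * (7 * x * y - (x\<^sup>2 + y\<^sup>2 - x - y + 1))
      = Qc b' * (7 * x * y - (x\<^sup>2 + y\<^sup>2 - x - y + 1))"
    and "7 * x * y - (x\<^sup>2 + y\<^sup>2 - x - y + 1) \<noteq> 0"
    using assms(1) by (auto simp: good_def)
  then show ?thesis
    by simp
qed

text \<open>Different j give different values of Q, hence disjoint conics; on one conic the first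
  coordinate is strictly increasing in m.\<close>

lemma pt_inject:
  assumes "pt j m = pt j' m'"
  shows "j = j' \<and> m = m'"
proof -
  obtain x y where "pt j m = (x, y)"
    by fastforce
  moreover from this have "pt j' m' = (x, y)"
    using assms by simp
  ultimately have "good (pb j) (x, y)" "good (pb j') (x, y)"
    using good_pt by metis+
  then have "Qc (pb j) = Qc (pb j')"
    by (rule conic_unique)
  moreover have "pb j \<ge> 0" "pb j' \<ge> 0"
    using pell_pell_seq by (auto simp: pell_def intro: order_trans[of 0 24])
  ultimately have "pb j = pb j'"
    by (simp add: Qc_def)
  then have "j = j'"
    using strict_mono_eq[OF strict_mono_pb] by simp
  with assms show ?thesis
    using strict_mono_pt[of j] by (metis strict_mono_eq)
qed

lemma good_imp_surface_point:
  assumes "good b (x, y)"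
  shows "\<exists>z. x * y * z = x ^ 3 + y ^ 3 + 1"
proof -
  obtain n where n: "x + y + 1 = Qc b * n"
    using assms by (auto simp: good_def)
  with surface_point_of_conic_point[OF _ n] assms show ?thesis
    by (auto simp: good_def)
qed

section \<open>Counting\<close>

text \<open>Needed for the lower bound, since \<open>card\<close> of an infinite set is 0.\<close>

lemma finite_points_upto: "finite (points_upto N)"
proof (rule finite_subset)
  show "points_upto N \<subseteq>
      (\<lambda>(x, y). (x, y, (x ^ 3 + y ^ 3 + 1) div (x * y))) ` ({1..\<lfloor>N\<rfloor>} \<times> {1..\<lfloor>N\<rfloor>})"
  proof
    fix p
    assume "p \<in> points_upto N"
    then obtain x y z where p: "p = (x, y, z)" "x * y * z = x ^ 3 + y ^ 3 + 1"
      "1 \<le> x" "real_of_int x \<le> N" "1 \<le> y" "real_of_int y \<le> N"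
      by (auto simp: points_upto_def)
    then have "z = (x ^ 3 + y ^ 3 + 1) div (x * y)"
      by (metis nonzero_mult_div_cancel_left mult_eq_0_iff not_one_le_zero)
    with p show "p \<in> (\<lambda>(x, y). (x, y, (x ^ 3 + y ^ 3 + 1) div (x * y))) ` ({1..\<lfloor>N\<rfloor>} \<times> {1..\<lfloor>N\<rfloor>})"
      by (auto simp: le_floor_iff image_iff)
  qed
qed simp

lemma card_points_upto_ge:
  fixes M :: nat
  assumes "(329 ^ 15) ^ M \<le> N"
  shows "card (points_upto N) \<ge> (\<Sum>i = 1..M. M div i)"
proof -
  \<comment> \<open>The lattice points with i k <= M. Indices start at 1 here and at 0 in
    \<open>pt\<close>, so \<open>Suc j * Suc m\<close> becomes i k.\<close>
  define I where "I = (SIGMA i:{1..M}. {1..M div i})"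
  define f where "f = (\<lambda>(i :: nat, k :: nat). pt (i - 1) (k - 1))"
  define g :: "int \<times> int \<times> int \<Rightarrow> int \<times> int" where "g = (\<lambda>(x, y, z). (x, y))"
  have "inj_on f I"
  proof (rule inj_onI)
    fix p q
    assume "p \<in> I" "q \<in> I" "f p = f q"
    moreover from this have "fst p - 1 = fst q - 1 \<and> snd p - 1 = snd q - 1"
      unfolding f_def case_prod_beta by (intro pt_inject)
    ultimately show "p = q"
      by (auto simp: I_def)
  qed
  moreover have "f ` I \<subseteq> g ` points_upto N"
  proof (rule image_subsetI)
    fix p
    assume "p \<in> I"
    then obtain i k where p: "p = (i, k)" and ik: "1 \<le> i" "1 \<le> k" "k \<le> M div i"
      by (auto simp: I_def)
    obtain x y where f: "f p = (x, y)"
      by fastforce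
    have "i * k \<le> M"
      using ik by (metis div_times_less_eq_dividend le_trans mult.commute mult_le_mono2)
    moreover have "x \<le> (329 ^ 15) ^ (i * k)"
      using pt_le[of "i - 1" "k - 1"] f ik by (simp add: f_def p)
    ultimately have "x \<le> (329 ^ 15) ^ M"
      by (meson order_trans power_increasing one_le_power one_le_numeral)
    then have "real_of_int x \<le> real_of_int ((329 ^ 15) ^ M)"
      by (subst of_int_le_iff)
    also have "\<dots> \<le> N"
      using assms by simp
    finally have "real_of_int x \<le> N" .
    moreover have "good (pb (i - 1)) (x, y)"
      using good_pt[of "i - 1" "k - 1"] f by (simp add: f_def p)
    moreover from this obtain z where "x * y * z = x ^ 3 + y ^ 3 + 1"
      using good_imp_surface_point by blast
    ultimately have "(x, y, z) \<in> points_upto N"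
      by (auto simp: points_upto_def good_def)
    then show "f p \<in> g ` points_upto N"
      unfolding f by (force simp: g_def)
  qed
  ultimately have "card I \<le> card (points_upto N)"
    by (metis card_image card_image_le card_mono finite_imageI finite_points_upto le_trans)
  then show ?thesis
    by (simp add: I_def)
qed

lemma ln_le_harmonic_sum: "ln (real M + 1) \<le> (\<Sum>i = 1..M. 1 / real i)"
proof (induction M)
  case (Suc M)
  \<comment> \<open>The logarithm telescopes, and ln (1 + h) <= h bounds each increment.\<close>
  have "real (Suc M) + 1 = (real M + 1) * (1 + 1 / real (Suc M))"
    by (simp add: field_simps)
  then have "ln (real (Suc M) + 1) = ln ((real M + 1) * (1 + 1 / real (Suc M)))"
    by (simp only:)
  also have "\<dots> = ln (real M + 1) + ln (1 + 1 / real (Suc M))"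
    by (intro ln_mult_pos; simp add: add_pos_nonneg add_nonneg_pos)
  also have "\<dots> \<le> ln (real M + 1) + 1 / real (Suc M)"
    by (intro add_left_mono ln_add_one_self_le_self) auto
  finally show ?case
    using Suc by simp
qed simp

lemma divisor_sum_ge: "real (\<Sum>i = 1..M. M div i) \<ge> real M / 2 * ln (real M + 1)"
proof -
  have "real M / 2 * ln (real M + 1) \<le> real M / 2 * (\<Sum>i = 1..M. 1 / real i)"
    using ln_le_harmonic_sum by (intro mult_left_mono) auto
  also have "\<dots> = (\<Sum>i = 1..M. real M / real i / 2)"
    by (simp add: sum_distrib_left mult.commute)
  \<comment> \<open>Rounding down a number that is at least 1 loses at most half of it.\<close>
  also have "\<dots> \<le> (\<Sum>i = 1..M. real (M div i))"
  proof (intro sum_mono)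
    fix i
    assume "i \<in> {1..M}"
    then have "M div i \<ge> 1"
      by (auto simp: Suc_le_eq div_greater_zero_iff)
    then have "real (M div i) \<ge> 1"
      by linarith
    moreover have "real M / real i < real (M div i) + 1"
      by (metis floor_divide_of_nat_eq of_int_of_nat_eq real_of_int_floor_add_one_gt)
    moreover have "r / 2 \<le> q" if "1 \<le> q" "r < q + 1" for q r :: real
      using that by linarith
    ultimately show "real M / real i / 2 \<le> real (M div i)"
      by blast
  qed
  finally show ?thesis
    by simp
qed

theorem mainTheorem6:
  "\<exists>\<epsilon>::real. \<epsilon> > 0 \<and>
     (\<forall>\<^sub>F N::real in at_top. real (card (points_upto N)) \<ge> \<epsilon> * ln N * ln (ln N))"
proof -
  define c :: real where "c = ln (329 ^ 15)"
  have c: "c \<ge> 1"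
  proof -
    have "exp 1 \<le> (3 :: real)"
      by (rule exp_le)
    also have "\<dots> \<le> 329 ^ 15"
      by simp
    finally show ?thesis
      unfolding c_def by (subst ln_ge_iff) auto
  qed
  \<comment> \<open>The threshold gives c <= sqrt (ln N), so that ln (ln N / c) is at least half of
    ln (ln N). The constant 1 / (8 c) is the product of this half and the 1 / (4 c) in the bound for
    M / 2.\<close>
  have "real (card (points_upto N)) \<ge> 1 / (8 * c) * ln N * ln (ln N)" if N: "N \<ge> exp (c\<^sup>2)" for N
  proof -
    define M where "M = nat \<lfloor>ln N / c\<rfloor>"
    have "N > 0"
      using N by (meson exp_gt_zero less_le_trans)
    have "ln N \<ge> c\<^sup>2"
      using N \<open>N > 0\<close> by (subst ln_ge_iff)
    moreover have "c\<^sup>2 \<ge> c"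
      using c by (simp add: power2_eq_square)
    ultimately have "ln N \<ge> c" "ln N > 0"
      using c by linarith+
    have "ln N / c \<ge> 1"
      using c \<open>ln N \<ge> c\<close> by simp
    then have M: "real M \<le> ln N / c" "ln N / c < real M + 1" "real M \<ge> 1"
      using le_floor_iff[of 1 "ln N / c"] by (simp_all add: M_def)
    have "(329 ^ 15) ^ M = exp (c * real M)"
      by (simp add: c_def exp_of_nat2_mult)
    also have "\<dots> \<le> exp (ln N)"
      using M(1) c by (simp add: field_simps)
    finally have "real (card (points_upto N)) \<ge> real (\<Sum>i = 1..M. M div i)"
      using card_points_upto_ge[of M N] \<open>N > 0\<close> by (simp only: exp_ln of_nat_le_iff)
    moreover have "real (\<Sum>i = 1..M. M div i) \<ge> real M / 2 * ln (real M + 1)"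
      by (rule divisor_sum_ge)
    moreover have "real M / 2 * ln (real M + 1) \<ge> (ln N / (4 * c)) * (ln (ln N) / 2)"
    proof (intro mult_mono)
      show "ln N / (4 * c) \<le> real M / 2"
      proof -
        \<comment> \<open>As M is at least 1, M + 1 <= 2 M.\<close>
        have "ln N / c \<le> 2 * real M"
          using M(2,3) by linarith
        then show ?thesis
          using c by (simp add: field_simps)
      qed
      have "ln (c\<^sup>2) \<le> ln (ln N)"
        using \<open>ln N \<ge> c\<^sup>2\<close> c by (intro ln_mono) auto
      moreover have "ln (c\<^sup>2) = 2 * ln c" "ln c \<ge> 0"
        using c by (simp_all add: ln_realpow)
      ultimately have lnc: "2 * ln c \<le> ln (ln N)" "0 \<le> ln c"
        by auto
      then have "ln (ln N) / 2 \<le> ln (ln N) - ln c"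
        by simp
      also have "ln (ln N) - ln c = ln (ln N / c)"
        using \<open>ln N > 0\<close> c by (subst ln_div) auto
      also have "\<dots> \<le> ln (real M + 1)"
        using M(2) \<open>ln N > 0\<close> c by (intro ln_mono) auto
      finally show "ln (ln N) / 2 \<le> ln (real M + 1)" .
      show "0 \<le> ln (ln N) / 2"
        using lnc by simp
    qed auto
    ultimately show ?thesis
      by (simp add: field_simps)
  qed
  then have "\<forall>\<^sub>F N in at_top. real (card (points_upto N)) \<ge> 1 / (8 * c) * ln N * ln (ln N)"
    by (auto simp: eventually_at_top_linorder)
  with c show ?thesis
    by (intro exI[of _ "1 / (8 * c)"]) auto
qed

end
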